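(* Fix $k\ge1$ and $m\in\mathbb{N}$. Let $\pi_A,\pi_B$ be $\mathbb{S}^\infty[X]$-interpretations with tuples $\bar a=(a_1,\dots,a_n)$ from $A$ and $\bar b=(b_1,\dots,b_n)$ from $B$. Suppose there are a formula $\varphi(\bar x)$ of quantifier rank at most $m$ with $\pi_A[\![\varphi(\bar a)]\!]\ne\pi_B[\![\varphi(\bar b)]\!]$, a set $Y\subseteq X$, and a monomial $\mu$ that is $Y$-separating for $\pi_A[\![\varphi(\bar a)]\!]$ and $\pi_B[\![\varphi(\bar b)]\!]$ with $e_Y(\mu)<k$. Then Spoiler has a winning strategy in $G_{km}(\pi_A,\bar a,\pi_B,\bar b)$.
   Context: $X$ is a set of indeterminates. A monomial is a map $\mu:X\to\mathbb{N}\cup\{\infty\}$ (exponents, written $\prod_x x^{\mu(x)}$); monomials are multiplied by adding exponents. $\mu$ absorbs $\mu'$ if $\mu(x)\le\mu'(x)$ for all $x\in X$. The semiring $\mathbb{S}^\infty[X]$ of generalised absorptive polynomials consists of the antichains of monomials with respect to absorption (no monomial absorbing another), with $0$ the empty antichain and $1$ the antichain containing only the monomial with all exponents $0$; $p+q$ is the set of non-absorbed monomials of $p\cup q$ and $p\cdot q$ is the set of non-absorbed monomials among the products $\mu\nu$, $\mu\in p,\nu\in q$. It is absorptive; infinite sums are suprema and infinite products infima (in the natural order) of finite partial sums/products. For $Y\subseteq X$: $\mu$ $Y$-absorbs $\mu'$ if $\mu(x)\le\mu'(x)$ for all $x\in Y$; $\mu$ is $Y$-separating for polynomials $p,q$ if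 $\mu$ belongs to one of $p,q$ and is not $Y$-absorbed by any monomial of the other; $e_Y(\mu)=\sum_{x\in Y}\mu(x)$. For a finite relational vocabulary $\tau$ and universe $A$, an $\mathbb{S}^\infty[X]$-interpretation maps the literals $R\bar a,\neg R\bar a$ to $\mathbb{S}^\infty[X]$; formulae in negation normal form are evaluated with equalities by truth value ($1$/$0$), literals by $\pi$, $\vee,\exists$ by sums, $\wedge,\forall$ by products over the universe. The game $G_k(\pi_A,\bar a,\pi_B,\bar b)$: $k$ rounds in which Spoiler picks an element of one universe and Duplicator one of the other; Duplicator wins iff the final map of tuples is a local isomorphism (same equality pattern, equal values on all $\tau$-literals).
   Formalization: The set X of indeterminates is assumed finite; for infinite X the antichains of monomials with these operations do not form a semiring and the suprema needed to evaluate ∃ over infinite universes need not exist. *)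

theory Defs
  imports "HOL-Algebra.Ring" "HOL-Library.Extended_Nat"
begin

text \<open>A monomial over \<open>X\<close> is a total exponent function that is 0 outside \<open>X\<close>, so that equality of
  monomials is equality of their restrictions to \<open>X\<close>.\<close>

type_synonym 'x monomial = "'x \<Rightarrow> enat"

definition monomials :: "'x set \<Rightarrow> 'x monomial set" where
  "monomials X = {\<mu>. \<forall>x. x \<notin> X \<longrightarrow> \<mu> x = 0}"

definition absorbs :: "'x set \<Rightarrow> 'x monomial \<Rightarrow> 'x monomial \<Rightarrow> bool" where
  "absorbs Y \<mu> \<mu>' \<longleftrightarrow> (\<forall>x\<in>Y. \<mu> x \<le> \<mu>' x)"

definition nonabsorbed :: "'x set \<Rightarrow> 'x monomial set \<Rightarrow> 'x monomial set" where
  "nonabsorbed X M = {\<mu> \<in> M. \<not> (\<exists>\<nu>\<in>M. \<nu> \<noteq> \<mu> \<and> absorbs X \<nu> \<mu>)}"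

definition absorptive_polys :: "'x set \<Rightarrow> 'x monomial set ring" where
  "absorptive_polys X =
    \<lparr>carrier = {p. p \<subseteq> monomials X \<and> (\<forall>\<mu>\<in>p. \<forall>\<nu>\<in>p. absorbs X \<mu> \<nu> \<longrightarrow> \<mu> = \<nu>)},
     monoid.mult = (\<lambda>p q. nonabsorbed X {(\<lambda>x. \<mu> x + \<nu> x) | \<mu> \<nu>. \<mu> \<in> p \<and> \<nu> \<in> q}),
     one = {\<lambda>x. 0},
     zero = {},
     add = (\<lambda>p q. nonabsorbed X (p \<union> q))\<rparr>"

definition separating ::
  "'x set \<Rightarrow> 'x monomial \<Rightarrow> 'x monomial set \<Rightarrow> 'x monomial set \<Rightarrow> bool" where
  "separating Y \<mu> p q \<longleftrightarrow>
    (\<mu> \<in> p \<and> \<not> (\<exists>\<nu>\<in>q. absorbs Y \<nu> \<mu>)) \<or> (\<mu> \<in> q \<and> \<not> (\<exists>\<nu>\<in>p. absorbs Y \<nu> \<mu>))"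

definition exponent_sum :: "'x set \<Rightarrow> 'x monomial \<Rightarrow> enat" where
  "exponent_sum Y \<mu> = (\<Sum>x\<in>Y. \<mu> x)"

definition natural_le :: "('k, 'z) ring_scheme \<Rightarrow> 'k \<Rightarrow> 'k \<Rightarrow> bool" where
  "natural_le K p q \<longleftrightarrow> (\<exists>r\<in>carrier K. p \<oplus>\<^bsub>K\<^esub> r = q)"

definition is_supremum :: "('k, 'z) ring_scheme \<Rightarrow> 'k set \<Rightarrow> 'k \<Rightarrow> bool" where
  "is_supremum K P s \<longleftrightarrow>
    s \<in> carrier K \<and> (\<forall>p\<in>P. natural_le K p s) \<and>
    (\<forall>t\<in>carrier K. (\<forall>p\<in>P. natural_le K p t) \<longrightarrow> natural_le K s t)"

definition is_infimum :: "('k, 'z) ring_scheme \<Rightarrow> 'k set \<Rightarrow> 'k \<Rightarrow> bool" where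
  "is_infimum K P s \<longleftrightarrow>
    s \<in> carrier K \<and> (\<forall>p\<in>P. natural_le K s p) \<and>
    (\<forall>t\<in>carrier K. (\<forall>p\<in>P. natural_le K t p) \<longrightarrow> natural_le K t s)"

text \<open>Over a finite index type these are the ordinary finite sum and product: in an absorptive
  semiring the sum (product) over all indices is the greatest (least) of the finite partial
  sums (products).\<close>

definition big_sum :: "('k, 'z) ring_scheme \<Rightarrow> ('i \<Rightarrow> 'k) \<Rightarrow> 'k" where
  "big_sum K f = (THE s. is_supremum K {finsum K f F | F. finite F} s)"

definition big_prod :: "('k, 'z) ring_scheme \<Rightarrow> ('i \<Rightarrow> 'k) \<Rightarrow> 'k" where
  "big_prod K f = (THE s. is_infimum K {finprod K f F | F. finite F} s)"

text \<open>Universes are types \<open>'a\<close>; a vocabulary is a set of relation symbols with an arity function.\<close>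

datatype ('r, 'a) literal = Pos 'r "'a list" | Neg 'r "'a list"

definition interpretation_in ::
  "('k, 'z) ring_scheme \<Rightarrow> 'r set \<Rightarrow> ('r \<Rightarrow> nat) \<Rightarrow> (('r, 'a) literal \<Rightarrow> 'k) \<Rightarrow> bool" where
  "interpretation_in K \<tau> ar \<pi> \<longleftrightarrow>
    (\<forall>R\<in>\<tau>. \<forall>cs. length cs = ar R \<longrightarrow> \<pi> (Pos R cs) \<in> carrier K \<and> \<pi> (Neg R cs) \<in> carrier K)"

datatype 'r nnf =
    Equal nat nat
  | Unequal nat nat
  | Lit "('r, nat) literal"
  | Or "'r nnf" "'r nnf"
  | And "'r nnf" "'r nnf"
  | Exists nat "'r nnf"
  | Forall nat "'r nnf"

fun over_vocabulary :: "'r set \<Rightarrow> ('r \<Rightarrow> nat) \<Rightarrow> 'r nnf \<Rightarrow> bool" where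
  "over_vocabulary \<tau> ar (Equal i j) = True"
| "over_vocabulary \<tau> ar (Unequal i j) = True"
| "over_vocabulary \<tau> ar (Lit (Pos R vs)) = (R \<in> \<tau> \<and> length vs = ar R)"
| "over_vocabulary \<tau> ar (Lit (Neg R vs)) = (R \<in> \<tau> \<and> length vs = ar R)"
| "over_vocabulary \<tau> ar (Or \<phi> \<psi>) = (over_vocabulary \<tau> ar \<phi> \<and> over_vocabulary \<tau> ar \<psi>)"
| "over_vocabulary \<tau> ar (And \<phi> \<psi>) = (over_vocabulary \<tau> ar \<phi> \<and> over_vocabulary \<tau> ar \<psi>)"
| "over_vocabulary \<tau> ar (Exists i \<phi>) = over_vocabulary \<tau> ar \<phi>"
| "over_vocabulary \<tau> ar (Forall i \<phi>) = over_vocabulary \<tau> ar \<phi>"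

fun free_vars :: "'r nnf \<Rightarrow> nat set" where
  "free_vars (Equal i j) = {i, j}"
| "free_vars (Unequal i j) = {i, j}"
| "free_vars (Lit (Pos R vs)) = set vs"
| "free_vars (Lit (Neg R vs)) = set vs"
| "free_vars (Or \<phi> \<psi>) = free_vars \<phi> \<union> free_vars \<psi>"
| "free_vars (And \<phi> \<psi>) = free_vars \<phi> \<union> free_vars \<psi>"
| "free_vars (Exists i \<phi>) = free_vars \<phi> - {i}"
| "free_vars (Forall i \<phi>) = free_vars \<phi> - {i}"

fun quantifier_rank :: "'r nnf \<Rightarrow> nat" where
  "quantifier_rank (Equal i j) = 0"
| "quantifier_rank (Unequal i j) = 0"
| "quantifier_rank (Lit l) = 0"
| "quantifier_rank (Or \<phi> \<psi>) = max (quantifier_rank \<phi>) (quantifier_rank \<psi>)"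
| "quantifier_rank (And \<phi> \<psi>) = max (quantifier_rank \<phi>) (quantifier_rank \<psi>)"
| "quantifier_rank (Exists i \<phi>) = Suc (quantifier_rank \<phi>)"
| "quantifier_rank (Forall i \<phi>) = Suc (quantifier_rank \<phi>)"

fun nnf_value ::
  "('k, 'z) ring_scheme \<Rightarrow> (('r, 'a) literal \<Rightarrow> 'k) \<Rightarrow> (nat \<Rightarrow> 'a) \<Rightarrow> 'r nnf \<Rightarrow> 'k" where
  "nnf_value K \<pi> s (Equal i j) = (if s i = s j then \<one>\<^bsub>K\<^esub> else \<zero>\<^bsub>K\<^esub>)"
| "nnf_value K \<pi> s (Unequal i j) = (if s i \<noteq> s j then \<one>\<^bsub>K\<^esub> else \<zero>\<^bsub>K\<^esub>)"
| "nnf_value K \<pi> s (Lit (Pos R vs)) = \<pi> (Pos R (map s vs))"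
| "nnf_value K \<pi> s (Lit (Neg R vs)) = \<pi> (Neg R (map s vs))"
| "nnf_value K \<pi> s (Or \<phi> \<psi>) = nnf_value K \<pi> s \<phi> \<oplus>\<^bsub>K\<^esub> nnf_value K \<pi> s \<psi>"
| "nnf_value K \<pi> s (And \<phi> \<psi>) = nnf_value K \<pi> s \<phi> \<otimes>\<^bsub>K\<^esub> nnf_value K \<pi> s \<psi>"
| "nnf_value K \<pi> s (Exists i \<phi>) = big_sum K (\<lambda>c. nnf_value K \<pi> (s(i := c)) \<phi>)"
| "nnf_value K \<pi> s (Forall i \<phi>) = big_prod K (\<lambda>c. nnf_value K \<pi> (s(i := c)) \<phi>)"

text \<open>The value of \<open>\<phi>(a\<^sub>1,\<dots>,a\<^sub>n)\<close>, where variable \<open>i < n\<close> denotes the \<open>i\<close>-th entry of the list. It is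
  meaningful only if the free variables of \<open>\<phi>\<close> are below \<open>n\<close>.\<close>

definition nnf_value_at ::
  "('k, 'z) ring_scheme \<Rightarrow> (('r, 'a) literal \<Rightarrow> 'k) \<Rightarrow> 'r nnf \<Rightarrow> 'a list \<Rightarrow> 'k" where
  "nnf_value_at K \<pi> \<phi> as = nnf_value K \<pi> (\<lambda>i. as ! i) \<phi>"

definition local_isomorphism ::
  "'r set \<Rightarrow> ('r \<Rightarrow> nat) \<Rightarrow> (('r, 'a) literal \<Rightarrow> 'k) \<Rightarrow> 'a list
    \<Rightarrow> (('r, 'b) literal \<Rightarrow> 'k) \<Rightarrow> 'b list \<Rightarrow> bool" where
  "local_isomorphism \<tau> ar \<pi>\<^sub>A as \<pi>\<^sub>B bs \<longleftrightarrow>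
    length as = length bs \<and>
    (\<forall>i<length as. \<forall>j<length as. as ! i = as ! j \<longleftrightarrow> bs ! i = bs ! j) \<and>
    (\<forall>R\<in>\<tau>. \<forall>is. length is = ar R \<and> set is \<subseteq> {..<length as} \<longrightarrow>
      \<pi>\<^sub>A (Pos R (map (\<lambda>i. as ! i) is)) = \<pi>\<^sub>B (Pos R (map (\<lambda>i. bs ! i) is)) \<and>
      \<pi>\<^sub>A (Neg R (map (\<lambda>i. as ! i) is)) = \<pi>\<^sub>B (Neg R (map (\<lambda>i. bs ! i) is)))"

text \<open>A play is the list of pairs chosen in its rounds. A strategy of Spoiler maps the rounds
  played so far to his next choice, an element of the first (\<open>Inl\<close>) or second (\<open>Inr\<close>) universe.\<close>

definition play_follows :: "(('a \<times> 'b) list \<Rightarrow> 'a + 'b) \<Rightarrow> ('a \<times> 'b) list \<Rightarrow> bool" where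
  "play_follows \<sigma> ps \<longleftrightarrow>
    (\<forall>i<length ps. case \<sigma> (take i ps) of Inl c \<Rightarrow> fst (ps ! i) = c | Inr d \<Rightarrow> snd (ps ! i) = d)"

definition spoiler_wins ::
  "nat \<Rightarrow> 'r set \<Rightarrow> ('r \<Rightarrow> nat) \<Rightarrow> (('r, 'a) literal \<Rightarrow> 'k) \<Rightarrow> 'a list
    \<Rightarrow> (('r, 'b) literal \<Rightarrow> 'k) \<Rightarrow> 'b list \<Rightarrow> bool" where
  "spoiler_wins k \<tau> ar \<pi>\<^sub>A as \<pi>\<^sub>B bs \<longleftrightarrow>
    (\<exists>\<sigma>. \<forall>ps. length ps = k \<and> play_follows \<sigma> ps \<longrightarrow>
      \<not> local_isomorphism \<tau> ar \<pi>\<^sub>A (as @ map fst ps) \<pi>\<^sub>B (bs @ map snd ps))"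

end

theory Submission
  imports Defs
begin

text \<open>A polynomial is determined by the up-set of the monomials it absorbs. On up-sets, sums are
  unions, products are Minkowski sums, and infinite products are intersections over the finite
  partial products; replacing absorption by \<open>Y\<close>-absorption respects all of this. A separating
  monomial is thus one lying in the up-set of one value only, and it can be followed down the
  formula. At a universal quantifier, some finite product on the side missing \<open>\<mu>\<close> already misses it.
  Spoiler plays the factors of that product that do not absorb the unit monomial, or \<open>k\<close> of them if
  there are more. If the answers are distinct, splitting \<open>\<mu>\<close> over the answers gives a summand that
  separates one of the pairs, because fewer than \<open>k\<close> summands can be nonzero on \<open>Y\<close>.
  So each quantifier costs at most \<open>k\<close> rounds.\<close>

section \<open>Up-sets of polynomials\<close>

definition upset :: "'x set \<Rightarrow> 'x monomial set \<Rightarrow> 'x monomial set" where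
  "upset Y p = {\<mu>. \<exists>\<nu>\<in>p. absorbs Y \<nu> \<mu>}"

text \<open>The product before absorbed monomials are dropped; it is associative and commutative on
  the nose.\<close>

definition products :: "'x monomial set \<Rightarrow> 'x monomial set \<Rightarrow> 'x monomial set" where
  "products p q = {(\<lambda>x. \<mu> x + \<nu> x) | \<mu> \<nu>. \<mu> \<in> p \<and> \<nu> \<in> q}"

lemma absorbs_refl: "absorbs Y \<mu> \<mu>"
  by (simp add: absorbs_def)

lemma absorbs_trans: "absorbs Y \<mu> \<nu> \<Longrightarrow> absorbs Y \<nu> \<xi> \<Longrightarrow> absorbs Y \<mu> \<xi>"
  unfolding absorbs_def by (meson order_trans)

lemma absorbs_subset: "Y \<subseteq> X \<Longrightarrow> absorbs X \<mu> \<nu> \<Longrightarrow> absorbs Y \<mu> \<nu>"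
  unfolding absorbs_def by blast

lemma absorbs_add:
  "absorbs Y \<mu> \<mu>' \<Longrightarrow> absorbs Y \<nu> \<nu>' \<Longrightarrow> absorbs Y (\<lambda>x. \<mu> x + \<nu> x) (\<lambda>x. \<mu>' x + \<nu>' x)"
  unfolding absorbs_def by (simp add: add_mono)

lemma monomials_eqI:
  assumes "\<mu> \<in> monomials X" "\<nu> \<in> monomials X" "\<And>x. x \<in> X \<Longrightarrow> \<mu> x = \<nu> x"
  shows "\<mu> = \<nu>"
proof
  fix x show "\<mu> x = \<nu> x"
    using assms by (cases "x \<in> X") (auto simp: monomials_def)
qed

lemma absorbs_antisym:
  "\<mu> \<in> monomials X \<Longrightarrow> \<nu> \<in> monomials X \<Longrightarrow> absorbs X \<mu> \<nu> \<Longrightarrow> absorbs X \<nu> \<mu> \<Longrightarrow> \<mu> = \<nu>"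
  by (rule monomials_eqI) (auto simp: absorbs_def intro: antisym)

lemma upset_Un: "upset Y (p \<union> q) = upset Y p \<union> upset Y q"
  unfolding upset_def by blast

lemma upset_absorbs: "\<mu> \<in> upset Y p \<Longrightarrow> absorbs Y \<mu> \<nu> \<Longrightarrow> \<nu> \<in> upset Y p"
  unfolding upset_def using absorbs_trans by blast

lemma in_upset: "\<mu> \<in> p \<Longrightarrow> \<mu> \<in> upset Y p"
  unfolding upset_def using absorbs_refl by blast

text \<open>The right-hand side sees the factors only through their up-sets, so factors with equal
  up-sets may replace each other.\<close>

lemma upset_products:
  "\<mu> \<in> upset Y (products p q) \<longleftrightarrow>
    (\<exists>\<mu>\<^sub>1\<in>upset Y p. \<exists>\<mu>\<^sub>2\<in>upset Y q. absorbs Y (\<lambda>x. \<mu>\<^sub>1 x + \<mu>\<^sub>2 x) \<mu>)" (is "?L \<longleftrightarrow> ?R")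
proof
  assume ?L
  then obtain \<mu>\<^sub>1 \<mu>\<^sub>2 where "\<mu>\<^sub>1 \<in> p" "\<mu>\<^sub>2 \<in> q" "absorbs Y (\<lambda>x. \<mu>\<^sub>1 x + \<mu>\<^sub>2 x) \<mu>"
    unfolding upset_def products_def by blast
  then show ?R using in_upset by blast
next
  assume ?R
  then obtain \<mu>\<^sub>1 \<mu>\<^sub>2 \<nu>\<^sub>1 \<nu>\<^sub>2 where
    *: "absorbs Y (\<lambda>x. \<mu>\<^sub>1 x + \<mu>\<^sub>2 x) \<mu>" "\<nu>\<^sub>1 \<in> p" "\<nu>\<^sub>2 \<in> q" "absorbs Y \<nu>\<^sub>1 \<mu>\<^sub>1" "absorbs Y \<nu>\<^sub>2 \<mu>\<^sub>2"
    unfolding upset_def by blast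
  then have "absorbs Y (\<lambda>x. \<nu>\<^sub>1 x + \<nu>\<^sub>2 x) \<mu>"
    using absorbs_trans absorbs_add by blast
  moreover have "(\<lambda>x. \<nu>\<^sub>1 x + \<nu>\<^sub>2 x) \<in> products p q"
    unfolding products_def using * by blast
  ultimately show ?L unfolding upset_def by blast
qed

lemma products_in_monomials:
  "p \<subseteq> monomials X \<Longrightarrow> q \<subseteq> monomials X \<Longrightarrow> products p q \<subseteq> monomials X"
  unfolding products_def monomials_def by fastforce

lemma products_memI: "\<mu> \<in> p \<Longrightarrow> \<nu> \<in> q \<Longrightarrow> (\<lambda>x. \<mu> x + \<nu> x) \<in> products p q"
  unfolding products_def by blast

lemma upset_products_cong:
  "upset Y p = upset Y p' \<Longrightarrow> upset Y q = upset Y q' \<Longrightarrow>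
    upset Y (products p q) = upset Y (products p' q')"
  by (rule Set.set_eqI) (simp add: upset_products)

lemma products_assoc: "products (products p q) r = products p (products q r)"
proof (intro equalityI subsetI)
  fix \<xi> assume "\<xi> \<in> products (products p q) r"
  then obtain \<rho> \<mu> \<nu> where mem: "\<rho> \<in> p" "\<mu> \<in> q" "\<nu> \<in> r"
    and \<xi>: "\<xi> = (\<lambda>x. \<rho> x + (\<mu> x + \<nu> x))"
    unfolding products_def by (auto simp: add.assoc)
  show "\<xi> \<in> products p (products q r)"
    unfolding \<xi> by (rule products_memI[OF mem(1) products_memI[OF mem(2,3)]])
next
  fix \<xi> assume "\<xi> \<in> products p (products q r)"
  then obtain \<rho> \<mu> \<nu> where mem: "\<rho> \<in> p" "\<mu> \<in> q" "\<nu> \<in> r"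
    and \<xi>: "\<xi> = (\<lambda>x. \<rho> x + \<mu> x + \<nu> x)"
    unfolding products_def by (auto simp: add.assoc)
  show "\<xi> \<in> products (products p q) r"
    unfolding \<xi> by (rule products_memI[OF products_memI[OF mem(1,2)] mem(3)])
qed

lemma products_commute: "products p q = products q p"
proof -
  have "products p q \<subseteq> products q p" for p q :: "'a monomial set"
    unfolding products_def by (clarify, metis add.commute)
  then show ?thesis by blast
qed

section \<open>Minimal monomials with respect to absorption\<close>

text \<open>Since \<open>enat\<close> is well-ordered, exponents can be minimised one indeterminate
  at a time: keep the monomials of least exponent at \<open>x\<close>, then minimise among these
  over the rest.\<close>

lemma ex_minimal_monomial:
  assumes "finite X" "M \<noteq> {}"
  shows "\<exists>\<mu>\<in>M. \<forall>\<nu>\<in>M. absorbs X \<nu> \<mu> \<longrightarrow> (\<forall>x\<in>X. \<nu> x = \<mu> x)"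
  using assms
proof (induction X arbitrary: M rule: finite_induct)
  case empty
  then show ?case by auto
next
  case (insert x X)
  define e where "e = (LEAST e. e \<in> (\<lambda>\<mu>. \<mu> x) ` M)"
  have e: "e \<in> (\<lambda>\<mu>. \<mu> x) ` M"
    unfolding e_def using insert.prems by (metis LeastI ex_in_conv image_is_empty)
  have least: "e \<le> \<nu> x" if "\<nu> \<in> M" for \<nu>
    unfolding e_def using that by (intro Least_le) blast
  from e have "{\<mu>\<in>M. \<mu> x = e} \<noteq> {}" by blast
  from insert.IH[OF this] obtain \<mu> where \<mu>: "\<mu> \<in> M" "\<mu> x = e"
    and min: "\<And>\<nu>. \<nu> \<in> M \<Longrightarrow> \<nu> x = e \<Longrightarrow> absorbs X \<nu> \<mu> \<Longrightarrow> (\<forall>x\<in>X. \<nu> x = \<mu> x)"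
    by blast
  have "\<forall>y\<in>insert x X. \<nu> y = \<mu> y" if "\<nu> \<in> M" "absorbs (insert x X) \<nu> \<mu>" for \<nu>
  proof -
    have "\<nu> x = e" using that \<mu> least[of \<nu>] by (simp add: absorbs_def)
    then show ?thesis using min[of \<nu>] that \<mu> by (simp add: absorbs_def)
  qed
  with \<mu> show ?case by blast
qed

text \<open>Every monomial of \<open>M\<close> is \<open>X\<close>-absorbed by a minimal one, which
  survives in \<open>nonabsorbed X M\<close>. Absorption on \<open>X\<close> implies absorption on
  \<open>Y\<close>, so \<open>Y\<close>-up-sets stay the same too.\<close>

lemma upset_nonabsorbed:
  assumes "finite X" "Y \<subseteq> X" "M \<subseteq> monomials X"
  shows "upset Y (nonabsorbed X M) = upset Y M"
proof
  show "upset Y (nonabsorbed X M) \<subseteq> upset Y M"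
    unfolding upset_def nonabsorbed_def by blast
  show "upset Y M \<subseteq> upset Y (nonabsorbed X M)"
  proof
    fix \<mu> assume "\<mu> \<in> upset Y M"
    then obtain \<nu> where \<nu>: "\<nu> \<in> M" "absorbs Y \<nu> \<mu>" unfolding upset_def by blast
    have "{\<xi>\<in>M. absorbs X \<xi> \<nu>} \<noteq> {}" using \<nu> absorbs_refl by blast
    from ex_minimal_monomial[OF assms(1) this] obtain \<xi> where
      \<xi>: "\<xi> \<in> M" "absorbs X \<xi> \<nu>"
      and min: "\<And>\<rho>. \<rho> \<in> M \<Longrightarrow> absorbs X \<rho> \<nu> \<Longrightarrow> absorbs X \<rho> \<xi> \<Longrightarrow> (\<forall>x\<in>X. \<rho> x = \<xi> x)"
      by blast
    have "\<rho> = \<xi>" if "\<rho> \<in> M" "absorbs X \<rho> \<xi>" for \<rho>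
    proof (rule monomials_eqI[of _ X])
      show "\<rho> x = \<xi> x" if "x \<in> X" for x
        using min[of \<rho>] \<open>\<rho> \<in> M\<close> \<open>absorbs X \<rho> \<xi>\<close> \<xi>(2) absorbs_trans that by blast
    qed (use that \<xi> assms in auto)
    then have "\<xi> \<in> nonabsorbed X M" unfolding nonabsorbed_def using \<xi> by blast
    moreover have "absorbs Y \<xi> \<mu>"
      using absorbs_trans[OF absorbs_subset[OF assms(2) \<xi>(2)] \<nu>(2)] .
    ultimately show "\<mu> \<in> upset Y (nonabsorbed X M)" unfolding upset_def by blast
  qed
qed

section \<open>Spoiler's strategies\<close>

lemma local_isomorphism_prefix:
  assumes "length as = length bs"
    and "local_isomorphism \<tau> ar \<pi>\<^sub>A (as @ cs) \<pi>\<^sub>B (bs @ ds)"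
  shows "local_isomorphism \<tau> ar \<pi>\<^sub>A as \<pi>\<^sub>B bs"
  unfolding local_isomorphism_def
proof (intro conjI allI impI ballI)
  have nth: "(as @ cs) ! i = as ! i \<and> (bs @ ds) ! i = bs ! i \<and> i < length (as @ cs)"
    if "i < length as" for i
    using that assms(1) by (simp add: nth_append)
  show "as ! i = as ! j \<longleftrightarrow> bs ! i = bs ! j" if "i < length as" "j < length as" for i j
    using assms(2) nth[OF that(1)] nth[OF that(2)] unfolding local_isomorphism_def by metis
  fix R js assume R: "R \<in> \<tau>" and js: "length js = ar R \<and> set js \<subseteq> {..<length as}"
  then have "set js \<subseteq> {..<length (as @ cs)}" by auto
  moreover have "map (\<lambda>i. (as @ cs) ! i) js = map (\<lambda>i. as ! i) js"
    "map (\<lambda>i. (bs @ ds) ! i) js = map (\<lambda>i. bs ! i) js"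
    using js nth by auto
  ultimately show "\<pi>\<^sub>A (Pos R (map (\<lambda>i. as ! i) js)) = \<pi>\<^sub>B (Pos R (map (\<lambda>i. bs ! i) js))"
    "\<pi>\<^sub>A (Neg R (map (\<lambda>i. as ! i) js)) = \<pi>\<^sub>B (Neg R (map (\<lambda>i. bs ! i) js))"
    using assms(2) R js unfolding local_isomorphism_def by metis+
qed (rule assms(1))

lemma local_isomorphism_swap:
  "local_isomorphism \<tau> ar \<pi>\<^sub>A as \<pi>\<^sub>B bs \<Longrightarrow> local_isomorphism \<tau> ar \<pi>\<^sub>B bs \<pi>\<^sub>A as"
  unfolding local_isomorphism_def by simp

lemma spoiler_wins_if_not_local_isomorphism:
  assumes "length as = length bs" "\<not> local_isomorphism \<tau> ar \<pi>\<^sub>A as \<pi>\<^sub>B bs"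
  shows "spoiler_wins k \<tau> ar \<pi>\<^sub>A as \<pi>\<^sub>B bs"
  unfolding spoiler_wins_def using assms local_isomorphism_prefix by blast

text \<open>After \<open>k\<close> rounds the local isomorphism is already broken, and further pairs
  cannot repair it. This takes up the slack in the round counts.\<close>

lemma spoiler_wins_mono:
  assumes win: "spoiler_wins k \<tau> ar \<pi>\<^sub>A as \<pi>\<^sub>B bs" and len: "length as = length bs" and "k \<le> l"
  shows "spoiler_wins l \<tau> ar \<pi>\<^sub>A as \<pi>\<^sub>B bs"
proof -
  obtain \<sigma> where \<sigma>: "\<And>ps. length ps = k \<Longrightarrow> play_follows \<sigma> ps \<Longrightarrow>
      \<not> local_isomorphism \<tau> ar \<pi>\<^sub>A (as @ map fst ps) \<pi>\<^sub>B (bs @ map snd ps)"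
    using win unfolding spoiler_wins_def by blast
  have "\<not> local_isomorphism \<tau> ar \<pi>\<^sub>A (as @ map fst ps) \<pi>\<^sub>B (bs @ map snd ps)"
    if "length ps = l" "play_follows \<sigma> ps" for ps
  proof -
    have "play_follows \<sigma> (take k ps)"
      using that \<open>k \<le> l\<close>
      by (auto simp: play_follows_def min_def cong: sum.case_cong)
    then have "\<not> local_isomorphism \<tau> ar \<pi>\<^sub>A (as @ map fst (take k ps)) \<pi>\<^sub>B (bs @ map snd (take k ps))"
      using \<sigma>[of "take k ps"] that \<open>k \<le> l\<close> by simp
    then have "\<not> local_isomorphism \<tau> ar
        \<pi>\<^sub>A ((as @ map fst (take k ps)) @ map fst (drop k ps))
        \<pi>\<^sub>B ((bs @ map snd (take k ps)) @ map snd (drop k ps))"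
      using local_isomorphism_prefix[of "as @ map fst (take k ps)" "bs @ map snd (take k ps)"] len
      by fastforce
    then show ?thesis
      by (simp only: append_assoc flip: map_append) simp
  qed
  then show ?thesis unfolding spoiler_wins_def by blast
qed

text \<open>Lets the main induction keep the separating monomial on one fixed side, and turns a pick
  in the second universe into a pick in the first.\<close>

lemma spoiler_wins_swap:
  assumes "spoiler_wins k \<tau> ar \<pi>\<^sub>A as \<pi>\<^sub>B bs"
  shows "spoiler_wins k \<tau> ar \<pi>\<^sub>B bs \<pi>\<^sub>A as"
proof -
  obtain \<sigma> where \<sigma>: "\<And>ps. length ps = k \<Longrightarrow> play_follows \<sigma> ps \<Longrightarrow>
      \<not> local_isomorphism \<tau> ar \<pi>\<^sub>A (as @ map fst ps) \<pi>\<^sub>B (bs @ map snd ps)"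
    using assms unfolding spoiler_wins_def by blast
  define \<sigma>' where "\<sigma>' ps = (case \<sigma> (map prod.swap ps) of Inl c \<Rightarrow> Inr c | Inr d \<Rightarrow> Inl d)" for ps
  have "\<not> local_isomorphism \<tau> ar \<pi>\<^sub>B (bs @ map fst ps) \<pi>\<^sub>A (as @ map snd ps)"
    if "length ps = k" "play_follows \<sigma>' ps" for ps
  proof
    assume "local_isomorphism \<tau> ar \<pi>\<^sub>B (bs @ map fst ps) \<pi>\<^sub>A (as @ map snd ps)"
    then have "local_isomorphism \<tau> ar \<pi>\<^sub>A (as @ map fst (map prod.swap ps))
        \<pi>\<^sub>B (bs @ map snd (map prod.swap ps))"
      by (simp add: local_isomorphism_swap comp_def)
    moreover have "play_follows \<sigma> (map prod.swap ps)"
      using that(2) unfolding play_follows_def \<sigma>'_def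
      by (auto simp: take_map split: sum.splits)
    ultimately show False using \<sigma>[of "map prod.swap ps"] that(1) by simp
  qed
  then show ?thesis unfolding spoiler_wins_def by blast
qed

lemma play_follows_Cons:
  "play_follows \<sigma> (p # ps) \<longleftrightarrow>
    (case \<sigma> [] of Inl c \<Rightarrow> fst p = c | Inr d \<Rightarrow> snd p = d) \<and> play_follows (\<lambda>qs. \<sigma> (p # qs)) ps"
  by (simp add: play_follows_def All_less_Suc2 cong: sum.case_cong)

lemma spoiler_wins_pick:
  assumes "\<And>c. spoiler_wins k \<tau> ar \<pi>\<^sub>A (as @ [c]) \<pi>\<^sub>B (bs @ [d])"
  shows "spoiler_wins (Suc k) \<tau> ar \<pi>\<^sub>A as \<pi>\<^sub>B bs"
proof -
  obtain S where S: "\<And>c ps. length ps = k \<Longrightarrow> play_follows (S c) ps \<Longrightarrow>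
      \<not> local_isomorphism \<tau> ar \<pi>\<^sub>A (as @ [c] @ map fst ps) \<pi>\<^sub>B (bs @ [d] @ map snd ps)"
    using assms unfolding spoiler_wins_def append_assoc by metis
  \<comment> \<open>Duplicator's first answer selects the strategy for the remaining rounds, which
    sees only the later pairs.\<close>
  define \<sigma> where "\<sigma> qs = (case qs of [] \<Rightarrow> Inr d | q # qs \<Rightarrow> S (fst q) qs)" for qs
  have "\<not> local_isomorphism \<tau> ar \<pi>\<^sub>A (as @ map fst ps) \<pi>\<^sub>B (bs @ map snd ps)"
    if "length ps = Suc k" "play_follows \<sigma> ps" for ps
  proof -
    obtain p qs where ps: "ps = p # qs" using \<open>length ps = Suc k\<close> by (cases ps) auto
    have "snd p = d" "play_follows (S (fst p)) qs"
      using that(2) unfolding ps play_follows_Cons by (simp_all add: \<sigma>_def)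
    then show ?thesis using S[of qs "fst p"] that(1) by (simp add: ps)
  qed
  then show ?thesis unfolding spoiler_wins_def by blast
qed

text \<open>Spoiler fixes the block \<open>ds\<close> in advance and ignores the answers while
  playing it; only the remaining \<open>k\<close> rounds depend on \<open>cs\<close>.\<close>

lemma spoiler_wins_picks:
  assumes "\<And>cs. length cs = length ds \<Longrightarrow> spoiler_wins k \<tau> ar \<pi>\<^sub>A (as @ cs) \<pi>\<^sub>B (bs @ ds)"
  shows "spoiler_wins (k + length ds) \<tau> ar \<pi>\<^sub>A as \<pi>\<^sub>B bs"
  using assms
proof (induction ds arbitrary: as bs)
  case Nil
  then show ?case using Nil[of "[]"] by simp
next
  case (Cons d ds)
  have "spoiler_wins (k + length ds) \<tau> ar \<pi>\<^sub>A (as @ [c]) \<pi>\<^sub>B (bs @ [d])" for c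
  proof (rule Cons.IH)
    show "spoiler_wins k \<tau> ar \<pi>\<^sub>A ((as @ [c]) @ cs) \<pi>\<^sub>B ((bs @ [d]) @ ds)"
      if "length cs = length ds" for cs
      using Cons.prems[of "c # cs"] that by simp
  qed
  then show ?case using spoiler_wins_pick by fastforce
qed

section \<open>Variable assignments and the tuples of the game\<close>

text \<open>A play only extends the tuples, while a quantifier may overwrite a variable already in
  use. So assignments are kept apart from tuples and linked through a position common to both
  sides.\<close>

definition listed_on :: "nat set \<Rightarrow> (nat \<Rightarrow> 'a) \<Rightarrow> 'a list \<Rightarrow> (nat \<Rightarrow> 'b) \<Rightarrow> 'b list \<Rightarrow> bool" where
  "listed_on V s as t bs \<longleftrightarrow> (\<forall>v\<in>V. \<exists>j<length as. s v = as ! j \<and> t v = bs ! j)"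

text \<open>A whole block of pairs is appended, but \<open>v\<close> is bound to only one of them;
  the others are carried along as extra entries.\<close>

lemma listed_on_update:
  assumes "listed_on (V - {v}) s as t bs" "length as = length bs" "length cs = length ds"
    and i: "i < length cs"
  shows "listed_on V (s(v := cs ! i)) (as @ cs) (t(v := ds ! i)) (bs @ ds)"
  unfolding listed_on_def
proof
  fix w assume w: "w \<in> V"
  show "\<exists>j<length (as @ cs). (s(v := cs ! i)) w = (as @ cs) ! j \<and>
      (t(v := ds ! i)) w = (bs @ ds) ! j"
  proof (cases "w = v")
    case True
    then show ?thesis using assms by (intro exI[of _ "length as + i"]) (simp add: nth_append)
  next
    case False
    then obtain j where "j < length as" "s w = as ! j" "t w = bs ! j"
      using assms(1) w unfolding listed_on_def by blast
    then show ?thesis using assms(2) False by (intro exI[of _ j]) (simp add: nth_append)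
  qed
qed

lemma listed_on_eq_iff:
  assumes "listed_on {i, j} s as t bs" "local_isomorphism \<tau> ar \<pi>\<^sub>A as \<pi>\<^sub>B bs"
  shows "s i = s j \<longleftrightarrow> t i = t j"
  using assms unfolding listed_on_def local_isomorphism_def by auto

lemma listed_on_literal_values:
  assumes "listed_on (set vs) s as t bs" "local_isomorphism \<tau> ar \<pi>\<^sub>A as \<pi>\<^sub>B bs"
    and "R \<in> \<tau>" "length vs = ar R"
  shows "\<pi>\<^sub>A (Pos R (map s vs)) = \<pi>\<^sub>B (Pos R (map t vs)) \<and>
    \<pi>\<^sub>A (Neg R (map s vs)) = \<pi>\<^sub>B (Neg R (map t vs))"
proof -
  obtain f where f: "\<And>v. v \<in> set vs \<Longrightarrow> f v < length as \<and> s v = as ! f v \<and> t v = bs ! f v"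
    using assms(1) unfolding listed_on_def by metis
  then have "map s vs = map (\<lambda>i. as ! i) (map f vs)" "map t vs = map (\<lambda>i. bs ! i) (map f vs)"
    "set (map f vs) \<subseteq> {..<length as}"
    by auto
  moreover have "length (map f vs) = ar R" using assms(4) by simp
  ultimately show ?thesis
    using assms(2,3) unfolding local_isomorphism_def by metis
qed

section \<open>The semiring of absorptive polynomials\<close>

lemma absorptive_polys_simps [simp]:
  "p \<in> carrier (absorptive_polys X) \<longleftrightarrow>
    p \<subseteq> monomials X \<and> (\<forall>\<mu>\<in>p. \<forall>\<nu>\<in>p. absorbs X \<mu> \<nu> \<longrightarrow> \<mu> = \<nu>)"
  "p \<otimes>\<^bsub>absorptive_polys X\<^esub> q = nonabsorbed X (products p q)"
  "p \<oplus>\<^bsub>absorptive_polys X\<^esub> q = nonabsorbed X (p \<union> q)"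
  "\<one>\<^bsub>absorptive_polys X\<^esub> = {\<lambda>x. 0}"
  "\<zero>\<^bsub>absorptive_polys X\<^esub> = {}"
  by (simp_all add: absorptive_polys_def products_def)

context
  fixes X :: "'x set"
  assumes finite_X: "finite X"
begin

abbreviation (input) "K \<equiv> absorptive_polys X"

lemma nonabsorbed_carrier: "M \<subseteq> monomials X \<Longrightarrow> nonabsorbed X M \<in> carrier K"
  unfolding absorptive_polys_simps nonabsorbed_def by blast

text \<open>If \<open>\<mu>\<close> in \<open>p\<close> is absorbed by some \<open>\<nu>\<close> in
  \<open>q\<close>, and that by some \<open>\<xi>\<close> in \<open>p\<close>, then
  \<open>\<xi>\<close> is \<open>\<mu>\<close> because \<open>p\<close> is an antichain, and so
  \<open>\<nu>\<close> is \<open>\<mu>\<close>. Identities of polynomials thus become identities of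
  up-sets.\<close>

lemma upset_inj:
  assumes "p \<in> carrier K" "q \<in> carrier K" "upset X p = upset X q"
  shows "p = q"
proof -
  have "p \<subseteq> q" if p: "p \<in> carrier K" and q: "q \<in> carrier K" and eq: "upset X p = upset X q" for p q
  proof
    fix \<mu> assume \<mu>: "\<mu> \<in> p"
    then obtain \<nu> where \<nu>: "\<nu> \<in> q" "absorbs X \<nu> \<mu>"
      using eq in_upset[of \<mu> p X] unfolding upset_def by blast
    then obtain \<xi> where \<xi>: "\<xi> \<in> p" "absorbs X \<xi> \<nu>"
      using eq in_upset[of \<nu> q X] unfolding upset_def by blast
    have "\<xi> = \<mu>" using absorbs_trans[OF \<xi>(2) \<nu>(2)] \<xi>(1) \<mu> p by simp
    then have "\<nu> = \<mu>" using absorbs_antisym[of \<nu> X \<mu>] \<mu> \<nu> \<xi> p q by auto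
    with \<nu> show "\<mu> \<in> q" by simp
  qed
  from this[OF assms] this[OF assms(2,1) assms(3)[symmetric]] show ?thesis by blast
qed

lemma the_poly_with_upset:
  assumes "p \<in> carrier K"
  shows "(THE q. q \<in> carrier K \<and> upset X q = upset X p) = p"
proof (rule the_equality)
  show "q = p" if "q \<in> carrier K \<and> upset X q = upset X p" for q
    using that assms by (intro upset_inj[of q p]) blast+
qed (use assms in blast)

lemma add_closed: "p \<in> carrier K \<Longrightarrow> q \<in> carrier K \<Longrightarrow> p \<oplus>\<^bsub>K\<^esub> q \<in> carrier K"
  unfolding absorptive_polys_simps(3) by (rule nonabsorbed_carrier) auto

lemma mult_closed: "p \<in> carrier K \<Longrightarrow> q \<in> carrier K \<Longrightarrow> p \<otimes>\<^bsub>K\<^esub> q \<in> carrier K"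
  unfolding absorptive_polys_simps(2) by (rule nonabsorbed_carrier, rule products_in_monomials) auto

lemma upset_add:
  assumes "Y \<subseteq> X" "p \<in> carrier K" "q \<in> carrier K"
  shows "upset Y (p \<oplus>\<^bsub>K\<^esub> q) = upset Y p \<union> upset Y q"
  using assms by (simp add: upset_nonabsorbed[OF finite_X] upset_Un)

lemma upset_mult:
  assumes "Y \<subseteq> X" "p \<in> carrier K" "q \<in> carrier K"
  shows "\<mu> \<in> upset Y (p \<otimes>\<^bsub>K\<^esub> q) \<longleftrightarrow>
    (\<exists>\<mu>\<^sub>1\<in>upset Y p. \<exists>\<mu>\<^sub>2\<in>upset Y q. absorbs Y (\<lambda>x. \<mu>\<^sub>1 x + \<mu>\<^sub>2 x) \<mu>)"
  using assms
  by (simp add: upset_nonabsorbed[OF finite_X] products_in_monomials upset_products)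

lemma upset_one: "upset Y \<one>\<^bsub>K\<^esub> = UNIV"
  by (simp add: upset_def absorbs_def)

lemma upset_zero: "upset Y \<zero>\<^bsub>K\<^esub> = {}"
  by (simp add: upset_def)

lemma one_closed: "\<one>\<^bsub>K\<^esub> \<in> carrier K"
  by (simp add: monomials_def)

lemma zero_closed: "\<zero>\<^bsub>K\<^esub> \<in> carrier K"
  by simp

section \<open>Monoid laws for sum and product\<close>

lemma abelian_monoid_polys: "abelian_monoid K"
proof (rule abelian_monoidI)
  fix p q r assume p: "p \<in> carrier K" and q: "q \<in> carrier K" and r: "r \<in> carrier K"
  show "p \<oplus>\<^bsub>K\<^esub> q \<oplus>\<^bsub>K\<^esub> r = p \<oplus>\<^bsub>K\<^esub> (q \<oplus>\<^bsub>K\<^esub> r)"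
    by (rule upset_inj) (use p q r in \<open>auto simp only: upset_add add_closed subset_refl\<close>)
next
  fix p q assume "p \<in> carrier K" "q \<in> carrier K"
  show "p \<oplus>\<^bsub>K\<^esub> q = q \<oplus>\<^bsub>K\<^esub> p" by (simp add: Un_commute)
next
  fix p assume p: "p \<in> carrier K"
  show "\<zero>\<^bsub>K\<^esub> \<oplus>\<^bsub>K\<^esub> p = p"
    by (rule upset_inj)
      (use p zero_closed in \<open>auto simp only: upset_add add_closed subset_refl upset_zero\<close>)
qed (fact add_closed zero_closed)+

lemma comm_monoid_polys: "comm_monoid K"
proof (rule comm_monoidI)
  fix p q r assume p: "p \<in> carrier K" and q: "q \<in> carrier K" and r: "r \<in> carrier K"
  show "p \<otimes>\<^bsub>K\<^esub> q \<otimes>\<^bsub>K\<^esub> r = p \<otimes>\<^bsub>K\<^esub> (q \<otimes>\<^bsub>K\<^esub> r)"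
  proof (rule upset_inj)
    \<comment> \<open>Up-sets do not notice the removal of absorbed monomials, so associativity
      reduces to that of \<open>products\<close>.\<close>
    have upset_mult_products: "upset X (p \<otimes>\<^bsub>K\<^esub> q) = upset X (products p q)"
      if "p \<in> carrier K" "q \<in> carrier K" for p q
      using that by (simp add: upset_nonabsorbed[OF finite_X] products_in_monomials)
    have "upset X (p \<otimes>\<^bsub>K\<^esub> q \<otimes>\<^bsub>K\<^esub> r) = upset X (products (products p q) r)"
      unfolding upset_mult_products[OF mult_closed[OF p q] r]
      by (rule upset_products_cong[OF upset_mult_products[OF p q] refl])
    moreover have "upset X (p \<otimes>\<^bsub>K\<^esub> (q \<otimes>\<^bsub>K\<^esub> r)) = upset X (products p (products q r))"
      unfolding upset_mult_products[OF p mult_closed[OF q r]]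
      by (rule upset_products_cong[OF refl upset_mult_products[OF q r]])
    ultimately show "upset X (p \<otimes>\<^bsub>K\<^esub> q \<otimes>\<^bsub>K\<^esub> r) = upset X (p \<otimes>\<^bsub>K\<^esub> (q \<otimes>\<^bsub>K\<^esub> r))"
      by (simp only: products_assoc)
  qed (intro mult_closed p q r)+
next
  fix p q assume "p \<in> carrier K" "q \<in> carrier K"
  show "p \<otimes>\<^bsub>K\<^esub> q = q \<otimes>\<^bsub>K\<^esub> p" by (simp add: products_commute)
next
  fix p assume p: "p \<in> carrier K"
  have "products {\<lambda>x. 0} p = p" unfolding products_def by simp
  moreover have "nonabsorbed X p = p" using p unfolding nonabsorbed_def by auto
  ultimately show "\<one>\<^bsub>K\<^esub> \<otimes>\<^bsub>K\<^esub> p = p" by simp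
qed (fact mult_closed one_closed)+

section \<open>Natural order, suprema and infima\<close>

text \<open>If the up-sets are nested, \<open>q\<close> itself serves as the summand. Suprema and
  infima are then found by uniting and intersecting up-sets.\<close>

lemma natural_le_iff:
  assumes "p \<in> carrier K" "q \<in> carrier K"
  shows "natural_le K p q \<longleftrightarrow> upset X p \<subseteq> upset X q"
proof
  assume "natural_le K p q"
  then show "upset X p \<subseteq> upset X q"
    unfolding natural_le_def using upset_add[OF subset_refl assms(1)] by blast
next
  assume "upset X p \<subseteq> upset X q"
  then have "p \<oplus>\<^bsub>K\<^esub> q = q"
    by (intro upset_inj[OF add_closed] assms) (use assms in \<open>auto simp only: upset_add subset_refl\<close>)
  then show "natural_le K p q" unfolding natural_le_def using assms by blast
qed

text \<open>The non-absorbed monomials of \<open>U\<close> generate it. This gives completeness: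
  unions and intersections of up-sets again come from polynomials.\<close>

lemma ex_poly_with_upset:
  assumes up: "\<And>\<mu> \<nu>. \<mu> \<in> U \<Longrightarrow> absorbs X \<mu> \<nu> \<Longrightarrow> \<nu> \<in> U"
  shows "\<exists>p\<in>carrier K. upset X p = U"
proof
  have "upset X (U \<inter> monomials X) = U"
  proof (intro equalityI subsetI)
    fix \<mu> assume "\<mu> \<in> upset X (U \<inter> monomials X)"
    then show "\<mu> \<in> U" using up unfolding upset_def by blast
  next
    fix \<mu> assume \<mu>: "\<mu> \<in> U"
    \<comment> \<open>Resetting the exponents outside \<open>X\<close> to 0 gives a genuine
      monomial, and \<open>X\<close>-absorption does not notice the change.\<close>
    let ?\<nu> = "\<lambda>x. if x \<in> X then \<mu> x else 0"
    have "?\<nu> \<in> U" using up[OF \<mu>] by (simp add: absorbs_def)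
    moreover have "?\<nu> \<in> monomials X" by (simp add: monomials_def)
    moreover have "absorbs X ?\<nu> \<mu>" by (simp add: absorbs_def)
    ultimately show "\<mu> \<in> upset X (U \<inter> monomials X)" unfolding upset_def by blast
  qed
  then show "upset X (nonabsorbed X (U \<inter> monomials X)) = U"
    by (simp add: upset_nonabsorbed[OF finite_X])
  show "nonabsorbed X (U \<inter> monomials X) \<in> carrier K"
    by (rule nonabsorbed_carrier) blast
qed

text \<open>The union is realised by some polynomial \<open>u\<close>, an upper bound; a least upper
  bound lies below \<open>u\<close> and above every member of \<open>P\<close>, so its up-set is the
  union.\<close>

lemma is_supremum_iff:
  assumes P: "P \<subseteq> carrier K"
  shows "is_supremum K P s \<longleftrightarrow> s \<in> carrier K \<and> upset X s = (\<Union>p\<in>P. upset X p)"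
proof -
  obtain u where u: "u \<in> carrier K" "upset X u = (\<Union>p\<in>P. upset X p)"
    using ex_poly_with_upset[of "\<Union>p\<in>P. upset X p"] upset_absorbs by blast
  have le: "natural_le K p t \<longleftrightarrow> upset X p \<subseteq> upset X t" if "t \<in> carrier K" "p \<in> P" for p t
    using natural_le_iff P that by blast
  show ?thesis
  proof
    assume s: "is_supremum K P s"
    then have c: "s \<in> carrier K" and ub: "\<forall>p\<in>P. natural_le K p s"
      and least: "\<And>t. t \<in> carrier K \<Longrightarrow> \<forall>p\<in>P. natural_le K p t \<Longrightarrow> natural_le K s t"
      unfolding is_supremum_def by blast+
    have "upset X s \<subseteq> upset X u"
      using least[OF u(1)] natural_le_iff[OF c u(1)] le[OF u(1)] u(2) by blast
    then show "s \<in> carrier K \<and> upset X s = (\<Union>p\<in>P. upset X p)"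
      using c u(2) ub le[OF c] by blast
  next
    assume s: "s \<in> carrier K \<and> upset X s = (\<Union>p\<in>P. upset X p)"
    then have c: "s \<in> carrier K" and eq: "upset X s = (\<Union>p\<in>P. upset X p)" by blast+
    show "is_supremum K P s"
      unfolding is_supremum_def
    proof (intro conjI ballI impI)
      show "natural_le K p s" if "p \<in> P" for p
        using le[OF c that] eq that by blast
      show "natural_le K s t" if "t \<in> carrier K" "\<forall>p\<in>P. natural_le K p t" for t
        using natural_le_iff[OF c that(1)] le[OF that(1)] that(2) eq by blast
    qed (rule c)
  qed
qed

lemma is_infimum_iff:
  assumes P: "P \<subseteq> carrier K"
  shows "is_infimum K P s \<longleftrightarrow> s \<in> carrier K \<and> upset X s = (\<Inter>p\<in>P. upset X p)"
proof -
  have "\<exists>u\<in>carrier K. upset X u = (\<Inter>p\<in>P. upset X p)"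
    by (rule ex_poly_with_upset) (auto intro: upset_absorbs)
  then obtain u where u: "u \<in> carrier K" "upset X u = (\<Inter>p\<in>P. upset X p)" by blast
  have le: "natural_le K t p \<longleftrightarrow> upset X t \<subseteq> upset X p" if "t \<in> carrier K" "p \<in> P" for p t
    using natural_le_iff P that by blast
  show ?thesis
  proof
    assume s: "is_infimum K P s"
    then have c: "s \<in> carrier K" and lb: "\<forall>p\<in>P. natural_le K s p"
      and greatest: "\<And>t. t \<in> carrier K \<Longrightarrow> \<forall>p\<in>P. natural_le K t p \<Longrightarrow> natural_le K t s"
      unfolding is_infimum_def by blast+
    have "upset X u \<subseteq> upset X s"
      using greatest[OF u(1)] natural_le_iff[OF u(1) c] le[OF u(1)] u(2) by blast
    then show "s \<in> carrier K \<and> upset X s = (\<Inter>p\<in>P. upset X p)"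
      using c u(2) lb le[OF c] by blast
  next
    assume s: "s \<in> carrier K \<and> upset X s = (\<Inter>p\<in>P. upset X p)"
    then have c: "s \<in> carrier K" and eq: "upset X s = (\<Inter>p\<in>P. upset X p)" by blast+
    show "is_infimum K P s"
      unfolding is_infimum_def
    proof (intro conjI ballI impI)
      show "natural_le K s p" if "p \<in> P" for p
        using le[OF c that] eq that by blast
      show "natural_le K t s" if "t \<in> carrier K" "\<forall>p\<in>P. natural_le K t p" for t
        using natural_le_iff[OF that(1) c] le[OF that(1)] that(2) eq by blast
    qed (rule c)
  qed
qed

text \<open>Filling the exponents outside \<open>Y\<close> with \<open>\<infinity>\<close> turns \<open>Y\<close>-absorption into absorption.\<close>

lemma upset_fill_infinity:
  assumes "Y \<subseteq> X"
  shows "\<mu> \<in> upset Y p \<longleftrightarrow> (\<lambda>x. if x \<in> Y then \<mu> x else \<infinity>) \<in> upset X p"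
proof -
  have "absorbs Y \<nu> \<mu> \<longleftrightarrow> absorbs X \<nu> (\<lambda>x. if x \<in> Y then \<mu> x else \<infinity>)" for \<nu>
    unfolding absorbs_def using assms by (auto split: if_splits)
  then show ?thesis unfolding upset_def by simp
qed

section \<open>Finite and infinite sums and products\<close>

lemma finsum_upset:
  assumes f: "\<And>i. f i \<in> carrier K" and "finite F"
  shows "finsum K f F \<in> carrier K \<and> upset X (finsum K f F) = (\<Union>i\<in>F. upset X (f i))"
  using assms(2)
proof (induction F rule: finite_induct)
  case empty
  interpret abelian_monoid K by (rule abelian_monoid_polys)
  show ?case using zero_closed upset_zero by simp
next
  case (insert a F)
  interpret abelian_monoid K by (rule abelian_monoid_polys)
  have "finsum K f (insert a F) = f a \<oplus>\<^bsub>K\<^esub> finsum K f F"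
    using insert f by (intro finsum_insert) auto
  then show ?case
    using insert f add_closed upset_add[OF subset_refl] by (metis UN_insert)
qed

text \<open>Iterating \<open>upset_mult\<close>, a monomial of the up-set splits, up to absorption,
  into one summand \<open>g i\<close> per factor. Such splittings are what the game argument carries
  from one structure to the other.\<close>

lemma finprod_closed_upset:
  assumes f: "\<And>i. f i \<in> carrier K" and "finite F" and Y: "Y \<subseteq> X"
  shows "finprod K f F \<in> carrier K \<and> (\<forall>\<mu>. \<mu> \<in> upset Y (finprod K f F) \<longleftrightarrow>
    (\<exists>g. (\<forall>i\<in>F. g i \<in> upset Y (f i)) \<and> absorbs Y (\<lambda>x. \<Sum>i\<in>F. g i x) \<mu>))"
  using assms(2)
proof (induction F rule: finite_induct)
  case empty
  interpret comm_monoid K by (rule comm_monoid_polys)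
  have "finprod K f {} = \<one>\<^bsub>K\<^esub>" by simp
  then show ?case using one_closed upset_one by (simp only:) (simp add: absorbs_def)
next
  case (insert a F)
  interpret comm_monoid K by (rule comm_monoid_polys)
  have eq: "finprod K f (insert a F) = f a \<otimes>\<^bsub>K\<^esub> finprod K f F"
    using insert f by (intro finprod_insert) auto
  have closed: "finprod K f F \<in> carrier K"
    and IH: "\<And>\<mu>. \<mu> \<in> upset Y (finprod K f F) \<longleftrightarrow>
      (\<exists>g. (\<forall>i\<in>F. g i \<in> upset Y (f i)) \<and> absorbs Y (\<lambda>x. \<Sum>i\<in>F. g i x) \<mu>)"
    using insert.IH by blast+
  have "\<mu> \<in> upset Y (finprod K f (insert a F)) \<longleftrightarrow>
    (\<exists>g. (\<forall>i\<in>insert a F. g i \<in> upset Y (f i)) \<and> absorbs Y (\<lambda>x. \<Sum>i\<in>insert a F. g i x) \<mu>)"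
    (is "?L \<longleftrightarrow> ?R") for \<mu>
  proof
    assume ?L
    then obtain \<mu>\<^sub>1 \<mu>\<^sub>2 where 1: "\<mu>\<^sub>1 \<in> upset Y (f a)" and 2: "\<mu>\<^sub>2 \<in> upset Y (finprod K f F)"
      and abs: "absorbs Y (\<lambda>x. \<mu>\<^sub>1 x + \<mu>\<^sub>2 x) \<mu>"
      unfolding eq upset_mult[OF Y f closed] by blast
    from 2 obtain g where g: "\<forall>i\<in>F. g i \<in> upset Y (f i)" "absorbs Y (\<lambda>x. \<Sum>i\<in>F. g i x) \<mu>\<^sub>2"
      unfolding IH by blast
    have "absorbs Y (\<lambda>x. \<mu>\<^sub>1 x + (\<Sum>i\<in>F. g i x)) \<mu>"
      using absorbs_trans[OF absorbs_add[OF absorbs_refl g(2)] abs] .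
    moreover have "(\<Sum>i\<in>insert a F. (g(a := \<mu>\<^sub>1)) i x) = \<mu>\<^sub>1 x + (\<Sum>i\<in>F. g i x)" for x
    proof -
      have "(\<Sum>i\<in>F. (g(a := \<mu>\<^sub>1)) i x) = (\<Sum>i\<in>F. g i x)"
        using insert by (intro sum.cong) auto
      then show ?thesis using insert by simp
    qed
    ultimately have "absorbs Y (\<lambda>x. \<Sum>i\<in>insert a F. (g(a := \<mu>\<^sub>1)) i x) \<mu>" by simp
    moreover have "\<forall>i\<in>insert a F. (g(a := \<mu>\<^sub>1)) i \<in> upset Y (f i)"
      using g 1 by simp
    ultimately show ?R by blast
  next
    assume ?R
    then obtain g where g: "\<forall>i\<in>insert a F. g i \<in> upset Y (f i)"
      and abs: "absorbs Y (\<lambda>x. \<Sum>i\<in>insert a F. g i x) \<mu>" by blast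
    have "(\<lambda>x. \<Sum>i\<in>F. g i x) \<in> upset Y (finprod K f F)"
      unfolding IH using g absorbs_refl by blast
    moreover have "absorbs Y (\<lambda>x. g a x + (\<Sum>i\<in>F. g i x)) \<mu>"
      using abs insert by simp
    ultimately show ?L
      unfolding eq upset_mult[OF Y f closed]
      by (intro bexI[of _ "g a"] bexI[of _ "\<lambda>x. \<Sum>i\<in>F. g i x"]) (simp_all add: g)
  qed
  then show ?case using eq mult_closed[OF f closed] by metis
qed

lemma big_sum_closed_upset:
  assumes f: "\<And>i. f i \<in> carrier K" and Y: "Y \<subseteq> X"
  shows "big_sum K f \<in> carrier K \<and> upset Y (big_sum K f) = (\<Union>i. upset Y (f i))"
proof -
  let ?P = "{finsum K f F | F. finite F}"
  have P: "?P \<subseteq> carrier K"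
    by (clarify, rule finsum_upset[OF f, THEN conjunct1])
  have "(\<Union>p\<in>?P. upset X p) = (\<Union>F\<in>{F. finite F}. upset X (finsum K f F))" by blast
  also have "\<dots> = (\<Union>F\<in>{F. finite F}. \<Union>i\<in>F. upset X (f i))"
    by (simp add: finsum_upset[OF f, THEN conjunct2])
  also have "\<dots> = (\<Union>i. upset X (f i))"
  proof (intro equalityI subsetI)
    fix \<mu> assume "\<mu> \<in> (\<Union>i. upset X (f i))"
    then obtain i where "\<mu> \<in> upset X (f i)" by blast
    then show "\<mu> \<in> (\<Union>F\<in>{F. finite F}. \<Union>i\<in>F. upset X (f i))"
      by (intro UN_I[of "{i}"]) auto
  qed blast
  finally have eq: "(\<Union>p\<in>?P. upset X p) = (\<Union>i. upset X (f i))" .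
  obtain s where s: "s \<in> carrier K" "upset X s = (\<Union>i. upset X (f i))"
    using ex_poly_with_upset[of "\<Union>i. upset X (f i)"] upset_absorbs by blast
  have "big_sum K f = s"
    unfolding big_sum_def is_supremum_iff[OF P] eq s(2)[symmetric]
    by (rule the_poly_with_upset[OF s(1)])
  \<comment> \<open>The natural order only controls \<open>X\<close>-up-sets. Filling with
    \<open>\<infinity>\<close> outside \<open>Y\<close> carries the identity over to
    \<open>Y\<close>.\<close>
  moreover have "upset Y s = (\<Union>i. upset Y (f i))"
    using s(2) by (auto simp: upset_fill_infinity[OF Y])
  ultimately show ?thesis using s by blast
qed

text \<open>The infimum intersects the up-sets of the finite partial products, so each finite
  \<open>F\<close> has its own splitting. A monomial outside the up-set is therefore missed by a
  single finite product.\<close>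

lemma big_prod_closed_upset:
  assumes f: "\<And>i. f i \<in> carrier K" and Y: "Y \<subseteq> X"
  shows "big_prod K f \<in> carrier K \<and> (\<forall>\<mu>. \<mu> \<in> upset Y (big_prod K f) \<longleftrightarrow>
    (\<forall>F. finite F \<longrightarrow>
      (\<exists>g. (\<forall>i\<in>F. g i \<in> upset Y (f i)) \<and> absorbs Y (\<lambda>x. \<Sum>i\<in>F. g i x) \<mu>)))"
proof -
  let ?P = "{finprod K f F | F. finite F}"
  have P: "?P \<subseteq> carrier K"
    by (clarify, rule finprod_closed_upset[OF f _ Y, THEN conjunct1])
  have eq: "(\<Inter>p\<in>?P. upset X p) = (\<Inter>F\<in>{F. finite F}. upset X (finprod K f F))" by blast
  have "\<exists>s\<in>carrier K. upset X s = (\<Inter>F\<in>{F. finite F}. upset X (finprod K f F))"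
    by (rule ex_poly_with_upset) (auto intro: upset_absorbs)
  then obtain s where s: "s \<in> carrier K"
      "upset X s = (\<Inter>F\<in>{F. finite F}. upset X (finprod K f F))"
    by blast
  have "big_prod K f = s"
    unfolding big_prod_def is_infimum_iff[OF P] eq s(2)[symmetric]
    by (rule the_poly_with_upset[OF s(1)])
  moreover have "\<mu> \<in> upset Y s \<longleftrightarrow> (\<forall>F. finite F \<longrightarrow> \<mu> \<in> upset Y (finprod K f F))" for \<mu>
    using s(2) by (auto simp: upset_fill_infinity[OF Y])
  ultimately show ?thesis
    using s(1) by (simp add: finprod_closed_upset[OF f _ Y, THEN conjunct2, rule_format]
        del: absorptive_polys_simps)
qed

lemma nnf_value_closed:
  assumes "interpretation_in K \<tau> ar \<pi>" "over_vocabulary \<tau> ar \<phi>"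
  shows "nnf_value K \<pi> s \<phi> \<in> carrier K"
  using assms(2)
proof (induction \<phi> arbitrary: s)
  case (Equal i j)
  then show ?case using one_closed zero_closed by simp
next
  case (Unequal i j)
  then show ?case using one_closed zero_closed by simp
next
  case (Lit l)
  then show ?case using assms(1)
    by (cases l) (auto simp: interpretation_in_def simp del: absorptive_polys_simps)
next
  case (Or \<phi> \<psi>)
  then show ?case using add_closed by (simp del: absorptive_polys_simps)
next
  case (And \<phi> \<psi>)
  then show ?case using mult_closed by (simp del: absorptive_polys_simps)
next
  case (Exists i \<phi>)
  then have "\<And>c. nnf_value K \<pi> (s(i := c)) \<phi> \<in> carrier K" by simp
  then show ?case
    unfolding nnf_value.simps by (rule big_sum_closed_upset[OF _ subset_refl, THEN conjunct1])
next
  case (Forall i \<phi>)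
  then have "\<And>c. nnf_value K \<pi> (s(i := c)) \<phi> \<in> carrier K" by simp
  then show ?case
    unfolding nnf_value.simps by (rule big_prod_closed_upset[OF _ subset_refl, THEN conjunct1])
qed

end

section \<open>Following a separating monomial\<close>

lemma exponent_sum_mono: "absorbs Y \<nu> \<mu> \<Longrightarrow> exponent_sum Y \<nu> \<le> exponent_sum Y \<mu>"
  unfolding absorbs_def exponent_sum_def by (rule sum_mono) blast

lemma exponent_sum_sum:
  "exponent_sum Y (\<lambda>x. \<Sum>i\<in>I. g i x) = (\<Sum>i\<in>I. exponent_sum Y (g i))"
  unfolding exponent_sum_def by (rule sum.swap)

section \<open>Comparing the products of a universal quantifier\<close>

text \<open>\<open>P\<close> and \<open>Q\<close> stand for the values under the quantifier on the
  two sides, \<open>cs\<close> for the answers to \<open>ds\<close>. The list \<open>ds\<close> is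
  fixed before \<open>cs\<close> is known; \<open>i\<close> and \<open>\<nu>\<close> may depend on
  \<open>cs\<close>. The bound on \<open>\<nu>\<close> lets the induction continue.\<close>

lemma ex_separated_factor:
  fixes P :: "'a \<Rightarrow> 'x monomial set" and Q :: "'b \<Rightarrow> 'x monomial set"
  assumes "finite Y" "finite F" and "exponent_sum Y \<mu> < enat k"
    and P: "\<And>E. finite E \<Longrightarrow>
      \<exists>g. (\<forall>c\<in>E. g c \<in> upset Y (P c)) \<and> absorbs Y (\<lambda>x. \<Sum>c\<in>E. g c x) \<mu>"
    and Q: "\<nexists>h. (\<forall>d\<in>F. h d \<in> upset Y (Q d)) \<and> absorbs Y (\<lambda>x. \<Sum>d\<in>F. h d x) \<mu>"
  shows "\<exists>ds. distinct ds \<and> length ds \<le> k \<and>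
    (\<forall>cs. length cs = length ds \<and> distinct cs \<longrightarrow>
      (\<exists>i<length ds. \<exists>\<nu>\<in>upset Y (P (cs ! i)).
        \<nu> \<notin> upset Y (Q (ds ! i)) \<and> exponent_sum Y \<nu> \<le> exponent_sum Y \<mu>))"
proof -
  \<comment> \<open>Factors outside \<open>F0\<close> can take the summand 0, so only those in
    \<open>F0\<close> obstruct a splitting.\<close>
  define F0 where "F0 = {d\<in>F. (\<lambda>x. 0) \<notin> upset Y (Q d)}"
  have F0: "F0 \<subseteq> F" "finite F0" unfolding F0_def using \<open>finite F\<close> by auto
  \<comment> \<open>The cap at \<open>k\<close> bounds the number of rounds. The disjunction
    prepares two contradictions: all obstructing factors are covered, or there are \<open>k\<close>
    of them.\<close>
  obtain F1 where F1: "F1 \<subseteq> F0" "card F1 \<le> k" "F1 = F0 \<or> card F1 = k"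
    by (metis nat_le_linear obtain_subset_with_card_n order_refl)
  then obtain ds where ds: "set ds = F1" "distinct ds"
    using F0(2) finite_distinct_list finite_subset by metis
  then have len: "length ds = card F1" by (metis distinct_card)
  have "\<exists>i<length ds. \<exists>\<nu>\<in>upset Y (P (cs ! i)).
      \<nu> \<notin> upset Y (Q (ds ! i)) \<and> exponent_sum Y \<nu> \<le> exponent_sum Y \<mu>"
    if cs: "length cs = length ds" "distinct cs" for cs
  proof (rule ccontr)
    assume contra: "\<not> ?thesis"
    \<comment> \<open>\<open>\<mu>\<close> is split over the answers; as these are distinct, each
      position gets a summand of its own.\<close>
    obtain g where g: "\<And>c. c \<in> set cs \<Longrightarrow> g c \<in> upset Y (P c)"
      and abs: "absorbs Y (\<lambda>x. \<Sum>c\<in>set cs. g c x) \<mu>"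
      using P[of "set cs"] by blast
    have sum_nth: "(\<Sum>c\<in>set cs. u c) = (\<Sum>i<length ds. u (cs ! i))" for u :: "'a \<Rightarrow> enat"
      using sum.reindex_bij_betw[OF bij_betw_nth[OF cs(2) refl refl], of u] cs(1) by simp
    \<comment> \<open>Each summand \<open>Y\<close>-absorbs \<open>\<mu>\<close>, so its exponent
      sum is within the bound; the denied conclusion then puts it into the up-set of the matching
      factor.\<close>
    have absQ: "g (cs ! i) \<in> upset Y (Q (ds ! i))" if i: "i < length ds" for i
    proof -
      have "cs ! i \<in> set cs" using i cs(1) by simp
      then have "absorbs Y (g (cs ! i)) (\<lambda>x. \<Sum>c\<in>set cs. g c x)"
        unfolding absorbs_def by (meson List.finite_set member_le_sum zero_le)
      then have "exponent_sum Y (g (cs ! i)) \<le> exponent_sum Y \<mu>"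
        using exponent_sum_mono absorbs_trans abs by blast
      then show ?thesis using contra i g[OF \<open>cs ! i \<in> set cs\<close>] by blast
    qed
    show False
    proof (cases "F1 = F0")
      case True
      define idx where "idx = the_inv_into {..<length ds} ((!) ds)"
      have inj: "inj_on ((!) ds) {..<length ds}" using ds(2) by (simp add: inj_on_nth)
      have idx: "idx (ds ! i) = i" if "i < length ds" for i
        unfolding idx_def using the_inv_into_f_f[OF inj] that by simp
      have img: "F0 = (!) ds ` {..<length ds}"
        using ds(1) True by (auto simp: set_conv_nth)
      \<comment> \<open>The summand of each answer moves to the element it answers, and all other
        factors get 0. This is a splitting over \<open>F\<close>, which was assumed not to
        exist.\<close>
      define h where "h d = (if d \<in> F0 then g (cs ! idx d) else (\<lambda>x. 0))" for d
      have "(\<Sum>d\<in>F. h d x) = (\<Sum>c\<in>set cs. g c x)" for x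
      proof -
        have "(\<Sum>d\<in>F. h d x) = (\<Sum>d\<in>F0. g (cs ! idx d) x)"
          using F0 \<open>finite F\<close> by (intro sum.mono_neutral_cong_right) (auto simp: h_def)
        also have "\<dots> = (\<Sum>i<length ds. g (cs ! i) x)"
          unfolding img by (subst sum.reindex[OF inj]) (auto simp: idx intro!: sum.cong)
        finally show ?thesis by (simp add: sum_nth)
      qed
      moreover have "h d \<in> upset Y (Q d)" if "d \<in> F" for d
      proof (cases "d \<in> F0")
        case True
        then obtain i where "i < length ds" "d = ds ! i" using img by blast
        then show ?thesis using absQ idx True by (simp add: h_def)
      next
        case False
        then show ?thesis using that by (simp add: h_def F0_def)
      qed
      ultimately show False
        using Q abs by (metis (no_types, lifting) ext)
    next
      case False
      then have k: "length ds = k" using F1 len by blast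
      \<comment> \<open>With exponent sum 0, finiteness of \<open>Y\<close> makes all exponents on
        \<open>Y\<close> vanish; then the unit monomial lies in an up-set from which the choice of
        \<open>F0\<close> excludes it.\<close>
      have pos: "1 \<le> exponent_sum Y (g (cs ! i))" if i: "i < length ds" for i
      proof (rule ccontr)
        assume "\<not> ?thesis"
        then have "exponent_sum Y (g (cs ! i)) = 0"
          by (metis ileI1 one_eSuc not_gr_zero)
        then have "absorbs Y (g (cs ! i)) (\<lambda>x. 0)"
          unfolding exponent_sum_def absorbs_def using \<open>finite Y\<close> by simp
        then have "(\<lambda>x. 0) \<in> upset Y (Q (ds ! i))" using upset_absorbs[OF absQ[OF i]] by blast
        moreover have "ds ! i \<in> F0" using ds(1) F1(1) i by auto
        ultimately show False unfolding F0_def by blast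
      qed
      have "enat k = (\<Sum>i<length ds. 1)" by (simp add: k of_nat_eq_enat)
      also have "\<dots> \<le> (\<Sum>i<length ds. exponent_sum Y (g (cs ! i)))"
        using pos by (intro sum_mono) simp
      also have "\<dots> = exponent_sum Y (\<lambda>x. \<Sum>c\<in>set cs. g c x)"
        by (simp add: exponent_sum_sum sum_nth)
      also have "\<dots> \<le> exponent_sum Y \<mu>" using abs by (rule exponent_sum_mono)
      finally show False using \<open>exponent_sum Y \<mu> < enat k\<close> by simp
    qed
  qed
  then show ?thesis using ds(2) len F1(2) by auto
qed

section \<open>Induction on the formula\<close>

text \<open>The invariant is membership in up-sets, because the monomial passed to a subformula need
  not occur in its value. Tuples, assignments and \<open>\<mu>\<close> vary in the induction;
  \<open>k\<close> and \<open>Y\<close> stay fixed.\<close>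

lemma spoiler_wins_if_separated:
  assumes X: "finite X" and Y: "Y \<subseteq> X"
    and A: "interpretation_in (absorptive_polys X) \<tau> ar \<pi>\<^sub>A"
    and B: "interpretation_in (absorptive_polys X) \<tau> ar \<pi>\<^sub>B"
    and "over_vocabulary \<tau> ar \<phi>" and "length as = length bs"
    and "listed_on (free_vars \<phi>) s as t bs"
    and "\<mu> \<in> upset Y (nnf_value (absorptive_polys X) \<pi>\<^sub>A s \<phi>)"
    and "\<mu> \<notin> upset Y (nnf_value (absorptive_polys X) \<pi>\<^sub>B t \<phi>)"
    and "exponent_sum Y \<mu> < enat k"
  shows "spoiler_wins (k * quantifier_rank \<phi>) \<tau> ar \<pi>\<^sub>A as \<pi>\<^sub>B bs"
  using assms(5-)
proof (induction \<phi> arbitrary: as bs s t \<mu>)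
  case (Equal i j)
  \<comment> \<open>A local isomorphism would force equal values, and no monomial lies in just one
    of two equal up-sets.\<close>
  have "\<not> local_isomorphism \<tau> ar \<pi>\<^sub>A as \<pi>\<^sub>B bs"
    using Equal listed_on_eq_iff[of i j s as t bs \<tau> ar \<pi>\<^sub>A \<pi>\<^sub>B]
    by (auto simp del: absorptive_polys_simps)
  then show ?case using Equal spoiler_wins_if_not_local_isomorphism by blast
next
  case (Unequal i j)
  have "\<not> local_isomorphism \<tau> ar \<pi>\<^sub>A as \<pi>\<^sub>B bs"
    using Unequal listed_on_eq_iff[of i j s as t bs \<tau> ar \<pi>\<^sub>A \<pi>\<^sub>B]
    by (auto simp del: absorptive_polys_simps)
  then show ?case using Unequal spoiler_wins_if_not_local_isomorphism by blast
next
  case (Lit l)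
  have "\<not> local_isomorphism \<tau> ar \<pi>\<^sub>A as \<pi>\<^sub>B bs"
  proof
    assume iso: "local_isomorphism \<tau> ar \<pi>\<^sub>A as \<pi>\<^sub>B bs"
    show False
      using Lit by (cases l) (auto dest: listed_on_literal_values[OF _ iso])
  qed
  then show ?case using Lit spoiler_wins_if_not_local_isomorphism by blast
next
  case (Or \<phi> \<psi>)
  have voc: "over_vocabulary \<tau> ar \<phi>" "over_vocabulary \<tau> ar \<psi>" using Or.prems by simp_all
  have listed: "listed_on (free_vars \<phi>) s as t bs" "listed_on (free_vars \<psi>) s as t bs"
    using Or.prems(3) by (simp_all add: listed_on_def)
  note closed = nnf_value_closed[OF X A] nnf_value_closed[OF X B]
  have "\<mu> \<notin> upset Y (nnf_value (absorptive_polys X) \<pi>\<^sub>B t \<phi>)"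
    "\<mu> \<notin> upset Y (nnf_value (absorptive_polys X) \<pi>\<^sub>B t \<psi>)"
    and "\<mu> \<in> upset Y (nnf_value (absorptive_polys X) \<pi>\<^sub>A s \<phi>) \<or>
      \<mu> \<in> upset Y (nnf_value (absorptive_polys X) \<pi>\<^sub>A s \<psi>)"
    using Or.prems(4,5)
    unfolding nnf_value.simps upset_add[OF X Y closed(1)[OF voc(1)] closed(1)[OF voc(2)]]
      upset_add[OF X Y closed(2)[OF voc(1)] closed(2)[OF voc(2)]] by blast+
  then have "spoiler_wins (k * quantifier_rank \<phi>) \<tau> ar \<pi>\<^sub>A as \<pi>\<^sub>B bs \<or>
      spoiler_wins (k * quantifier_rank \<psi>) \<tau> ar \<pi>\<^sub>A as \<pi>\<^sub>B bs"
    using Or.IH(1)[OF voc(1) Or.prems(2) listed(1) _ _ Or.prems(6)]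
      Or.IH(2)[OF voc(2) Or.prems(2) listed(2) _ _ Or.prems(6)] by blast
  then show ?case
    by (elim disjE) (erule spoiler_wins_mono[OF _ Or.prems(2)]; simp)+
next
  case (And \<phi> \<psi>)
  have voc: "over_vocabulary \<tau> ar \<phi>" "over_vocabulary \<tau> ar \<psi>" using And.prems by simp_all
  have listed: "listed_on (free_vars \<phi>) s as t bs" "listed_on (free_vars \<psi>) s as t bs"
    using And.prems(3) by (simp_all add: listed_on_def)
  note closed = nnf_value_closed[OF X A] nnf_value_closed[OF X B]
  \<comment> \<open>If both summands lay in the up-sets on the second side, \<open>\<mu>\<close>
    would lie in that of the product there. So one of them separates a conjunct.\<close>
  obtain \<mu>\<^sub>1 \<mu>\<^sub>2 where 1: "\<mu>\<^sub>1 \<in> upset Y (nnf_value (absorptive_polys X) \<pi>\<^sub>A s \<phi>)"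
    and 2: "\<mu>\<^sub>2 \<in> upset Y (nnf_value (absorptive_polys X) \<pi>\<^sub>A s \<psi>)"
    and abs: "absorbs Y (\<lambda>x. \<mu>\<^sub>1 x + \<mu>\<^sub>2 x) \<mu>"
    using And.prems(4)
    unfolding nnf_value.simps upset_mult[OF X Y closed(1)[OF voc(1)] closed(1)[OF voc(2)]] by blast
  then have not: "\<mu>\<^sub>1 \<notin> upset Y (nnf_value (absorptive_polys X) \<pi>\<^sub>B t \<phi>) \<or>
      \<mu>\<^sub>2 \<notin> upset Y (nnf_value (absorptive_polys X) \<pi>\<^sub>B t \<psi>)"
    using And.prems(5)
    unfolding nnf_value.simps upset_mult[OF X Y closed(2)[OF voc(1)] closed(2)[OF voc(2)]] by blast
  have "absorbs Y \<mu>\<^sub>1 (\<lambda>x. \<mu>\<^sub>1 x + \<mu>\<^sub>2 x)" "absorbs Y \<mu>\<^sub>2 (\<lambda>x. \<mu>\<^sub>1 x + \<mu>\<^sub>2 x)"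
    by (simp_all add: absorbs_def)
  then have less: "exponent_sum Y \<mu>\<^sub>1 < enat k" "exponent_sum Y \<mu>\<^sub>2 < enat k"
    using exponent_sum_mono absorbs_trans[OF _ abs] And.prems(6) order_le_less_trans by blast+
  have "spoiler_wins (k * quantifier_rank \<phi>) \<tau> ar \<pi>\<^sub>A as \<pi>\<^sub>B bs \<or>
      spoiler_wins (k * quantifier_rank \<psi>) \<tau> ar \<pi>\<^sub>A as \<pi>\<^sub>B bs"
    using not And.IH(1)[OF voc(1) And.prems(2) listed(1) 1 _ less(1)]
      And.IH(2)[OF voc(2) And.prems(2) listed(2) 2 _ less(2)] by blast
  then show ?case
    by (elim disjE) (erule spoiler_wins_mono[OF _ And.prems(2)]; simp)+
next
  case (Exists v \<phi>)
  have voc: "over_vocabulary \<tau> ar \<phi>" and listed: "listed_on (free_vars \<phi> - {v}) s as t bs"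
    using Exists.prems by simp_all
  note closed = nnf_value_closed[OF X A voc] nnf_value_closed[OF X B voc]
  note Y_sum = big_sum_closed_upset[OF X _ Y, THEN conjunct2]
  \<comment> \<open>Spoiler plays a witness \<open>c\<close> for \<open>\<mu>\<close>; every answer
    \<open>d\<close> misses the same \<open>\<mu>\<close>.\<close>
  obtain c where c: "\<mu> \<in> upset Y (nnf_value (absorptive_polys X) \<pi>\<^sub>A (s(v := c)) \<phi>)"
    using Exists.prems(4) unfolding nnf_value.simps Y_sum[OF closed(1)] by blast
  have d: "\<mu> \<notin> upset Y (nnf_value (absorptive_polys X) \<pi>\<^sub>B (t(v := d)) \<phi>)" for d
    using Exists.prems(5) unfolding nnf_value.simps Y_sum[OF closed(2)] by blast
  have "spoiler_wins (k * quantifier_rank \<phi>) \<tau> ar \<pi>\<^sub>A (as @ [c]) \<pi>\<^sub>B (bs @ [d])" for d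
  proof (rule Exists.IH[OF voc _ _ c d Exists.prems(6)])
    show "listed_on (free_vars \<phi>) (s(v := c)) (as @ [c]) (t(v := d)) (bs @ [d])"
      using listed_on_update[OF listed Exists.prems(2), of "[c]" "[d]" 0] by simp
  qed (simp add: Exists.prems)
  then have "spoiler_wins (Suc (k * quantifier_rank \<phi>)) \<tau> ar \<pi>\<^sub>B bs \<pi>\<^sub>A as"
    by (rule spoiler_wins_pick[OF spoiler_wins_swap])
  then have win: "spoiler_wins (Suc (k * quantifier_rank \<phi>)) \<tau> ar \<pi>\<^sub>A as \<pi>\<^sub>B bs"
    by (rule spoiler_wins_swap)
  \<comment> \<open>One round fits into the \<open>k\<close> rounds granted per quantifier only for
    positive \<open>k\<close>, which the exponent bound forces.\<close>
  have "k \<noteq> 0"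
    using Exists.prems(6) by (metis enat_0 not_iless0)
  then show ?case
    by (intro spoiler_wins_mono[OF win Exists.prems(2)]) simp
next
  case (Forall v \<phi>)
  have voc: "over_vocabulary \<tau> ar \<phi>" and listed: "listed_on (free_vars \<phi> - {v}) s as t bs"
    using Forall.prems by simp_all
  define P where "P = (\<lambda>c. nnf_value (absorptive_polys X) \<pi>\<^sub>A (s(v := c)) \<phi>)"
  define Q where "Q = (\<lambda>d. nnf_value (absorptive_polys X) \<pi>\<^sub>B (t(v := d)) \<phi>)"
  have closed: "P c \<in> carrier (absorptive_polys X)" "Q d \<in> carrier (absorptive_polys X)" for c d
    unfolding P_def Q_def using nnf_value_closed[OF X] A B voc by blast+
  note Y_prod = big_prod_closed_upset[OF X _ Y, THEN conjunct2, rule_format]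
  have "\<mu> \<in> upset Y (big_prod (absorptive_polys X) P)"
    "\<mu> \<notin> upset Y (big_prod (absorptive_polys X) Q)"
    using Forall.prems(4,5) by (simp_all add: P_def Q_def)
  \<comment> \<open>One finite \<open>F\<close> witnesses the failure on the second side, while the
    first side splits \<open>\<mu>\<close> over every finite \<open>E\<close>, in particular over
    answers not yet known.\<close>
  then obtain F where "finite F"
    and P: "\<And>E. finite E \<Longrightarrow>
      \<exists>g. (\<forall>c\<in>E. g c \<in> upset Y (P c)) \<and> absorbs Y (\<lambda>x. \<Sum>c\<in>E. g c x) \<mu>"
    and Q: "\<nexists>h. (\<forall>d\<in>F. h d \<in> upset Y (Q d)) \<and> absorbs Y (\<lambda>x. \<Sum>d\<in>F. h d x) \<mu>"
    unfolding Y_prod[of P, OF closed(1)] Y_prod[of Q, OF closed(2)] by blast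
  from ex_separated_factor[OF finite_subset[OF Y X] this(1) Forall.prems(6) P Q]
  obtain ds where ds: "distinct ds" "length ds \<le> k"
    and sep: "\<And>cs. length cs = length ds \<Longrightarrow> distinct cs \<Longrightarrow>
      \<exists>i<length ds. \<exists>\<nu>\<in>upset Y (P (cs ! i)).
        \<nu> \<notin> upset Y (Q (ds ! i)) \<and> exponent_sum Y \<nu> \<le> exponent_sum Y \<mu>"
    by blast
  have "spoiler_wins (k * quantifier_rank \<phi>) \<tau> ar \<pi>\<^sub>A (as @ cs) \<pi>\<^sub>B (bs @ ds)"
    if len: "length cs = length ds" for cs
  proof (cases "distinct cs")
    case True
    \<comment> \<open>The position \<open>i\<close> is chosen only after all answers are in;
      \<open>v\<close> is then bound to that pair.\<close>
    from sep[OF len this] obtain i \<nu> where i: "i < length ds"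
      and \<nu>: "\<nu> \<in> upset Y (P (cs ! i))" "\<nu> \<notin> upset Y (Q (ds ! i))"
      and le: "exponent_sum Y \<nu> \<le> exponent_sum Y \<mu>" by blast
    show ?thesis
    proof (rule Forall.IH[OF voc])
      show "listed_on (free_vars \<phi>) (s(v := cs ! i)) (as @ cs) (t(v := ds ! i)) (bs @ ds)"
        using listed_on_update[OF listed Forall.prems(2) len] i len by simp
      show "exponent_sum Y \<nu> < enat k" using le Forall.prems(6) by (rule order_le_less_trans)
      show "\<nu> \<in> upset Y (nnf_value (absorptive_polys X) \<pi>\<^sub>A (s(v := cs ! i)) \<phi>)"
        "\<nu> \<notin> upset Y (nnf_value (absorptive_polys X) \<pi>\<^sub>B (t(v := ds ! i)) \<phi>)"
        using \<nu> by (simp_all add: P_def Q_def)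
    qed (use len Forall.prems(2) in simp)
  next
    \<comment> \<open>Equal answers to distinct picks already violate the equality pattern.\<close>
    case False
    then obtain i j where ij: "i < length cs" "j < length cs" "i \<noteq> j" "cs ! i = cs ! j"
      by (auto simp: distinct_conv_nth)
    then have "ds ! i \<noteq> ds ! j" using ds(1) len by (simp add: nth_eq_iff_index_eq)
    then have "\<not> local_isomorphism \<tau> ar \<pi>\<^sub>A (as @ cs) \<pi>\<^sub>B (bs @ ds)"
      using ij len Forall.prems(2) unfolding local_isomorphism_def
      by (metis add_less_cancel_left length_append nth_append_length_plus)
    then show ?thesis
      using Forall.prems(2) len by (intro spoiler_wins_if_not_local_isomorphism) simp_all
  qed
  then have "spoiler_wins (k * quantifier_rank \<phi> + length ds) \<tau> ar \<pi>\<^sub>A as \<pi>\<^sub>B bs"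
    by (rule spoiler_wins_picks)
  then show ?case
    by (rule spoiler_wins_mono) (use Forall.prems(2) ds(2) in auto)
qed

theorem theorem4p4:
  fixes X Y :: "'x set" and \<tau> :: "'r set" and ar :: "'r \<Rightarrow> nat"
    and \<pi>\<^sub>A :: "('r, 'a) literal \<Rightarrow> 'x monomial set"
    and \<pi>\<^sub>B :: "('r, 'b) literal \<Rightarrow> 'x monomial set"
    and as :: "'a list" and bs :: "'b list"
    and \<phi> :: "'r nnf" and \<mu> :: "'x monomial" and k m n :: nat
  assumes "k \<ge> 1"
    and "finite X" and "finite \<tau>"
    and "interpretation_in (absorptive_polys X) \<tau> ar \<pi>\<^sub>A"
    and "interpretation_in (absorptive_polys X) \<tau> ar \<pi>\<^sub>B"
    and "length as = n" and "length bs = n"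
    and "over_vocabulary \<tau> ar \<phi>" and "free_vars \<phi> \<subseteq> {..<n}" and "quantifier_rank \<phi> \<le> m"
    and "nnf_value_at (absorptive_polys X) \<pi>\<^sub>A \<phi> as \<noteq> nnf_value_at (absorptive_polys X) \<pi>\<^sub>B \<phi> bs"
    and "Y \<subseteq> X"
    and "separating Y \<mu> (nnf_value_at (absorptive_polys X) \<pi>\<^sub>A \<phi> as)
           (nnf_value_at (absorptive_polys X) \<pi>\<^sub>B \<phi> bs)"
    and "exponent_sum Y \<mu> < enat k"
  shows "spoiler_wins (k * m) \<tau> ar \<pi>\<^sub>A as \<pi>\<^sub>B bs"
proof -
  \<comment> \<open>At the start, variable \<open>i\<close> sits at position \<open>i\<close> of
    both tuples.\<close>
  have listed: "listed_on (free_vars \<phi>) (\<lambda>i. as ! i) as (\<lambda>i. bs ! i) bs"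
    "listed_on (free_vars \<phi>) (\<lambda>i. bs ! i) bs (\<lambda>i. as ! i) as"
    using assms(6,7,9) by (auto simp: listed_on_def)
  note win = spoiler_wins_if_separated[OF assms(2) \<open>Y \<subseteq> X\<close> _ _ assms(8)]
  have "spoiler_wins (k * quantifier_rank \<phi>) \<tau> ar \<pi>\<^sub>A as \<pi>\<^sub>B bs"
    using assms(13) unfolding separating_def nnf_value_at_def
  proof (elim disjE conjE)
    assume "\<mu> \<in> nnf_value (absorptive_polys X) \<pi>\<^sub>A ((!) as) \<phi>"
      "\<not> (\<exists>\<nu>\<in>nnf_value (absorptive_polys X) \<pi>\<^sub>B ((!) bs) \<phi>. absorbs Y \<nu> \<mu>)"
    then show ?thesis
      by (intro win[OF assms(4,5) _ listed(1) in_upset _ assms(14)])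
        (simp_all add: upset_def assms(6,7))
  next
    \<comment> \<open>Here \<open>\<mu>\<close> comes from the second structure, so the game is won
      with the sides exchanged and then swapped back.\<close>
    assume "\<mu> \<in> nnf_value (absorptive_polys X) \<pi>\<^sub>B ((!) bs) \<phi>"
      "\<not> (\<exists>\<nu>\<in>nnf_value (absorptive_polys X) \<pi>\<^sub>A ((!) as) \<phi>. absorbs Y \<nu> \<mu>)"
    then show ?thesis
      by (intro spoiler_wins_swap[OF win[OF assms(5,4) _ listed(2) in_upset _ assms(14)]])
        (simp_all add: upset_def assms(6,7))
  qed
  then show ?thesis
    by (rule spoiler_wins_mono) (use assms(6,7,10) in simp_all)
qed

end
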